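(* Let $\mathbf{R}_u,\mathbf{R}_v,\mathbf{R}_0\in\mathbb{R}^3$ and $\mathbf{R}(u,v)=\mathbf{R}_u u+\mathbf{R}_v v+\mathbf{R}_0$. Define $$g_n^m(u,v)=R_n^m(\mathbf{R}(u,v)),\qquad j_n^m=\int_0^1 g_n^m(u,1-u)\,du,\qquad k_n^m=g_n^m(1,0).$$ Then for all integers $n\ge 1$ and $-n\le m\le n$, $$j_n^m=\frac{1}{n+1}\left[i(\xi_0+\xi_v)\,j_{n-1}^{m-1}+i(\eta_0+\eta_v)\,j_{n-1}^{m+1}-(z_0+z_v)\,j_{n-1}^m+k_n^m\right],$$ where, writing $\mathbf{R}_0=(x_0,y_0,z_0)$ and $\mathbf{R}_v=(x_v,y_v,z_v)$, $\xi_s=\frac{x_s+iy_s}{2}$ and $\eta_s=\frac{x_s-iy_s}{2}$ for $s\in\{0,v\}$.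
   Context: Harmonic polynomials: for $\mathbf{r}=(x,y,z)=r(\sin\theta\cos\varphi,\sin\theta\sin\varphi,\cos\theta)\in\mathbb{R}^3$, integers $n\ge 0$ and $-n\le m\le n$, $$R_n^m(\mathbf{r})=\frac{(-1)^n i^{|m|}}{(n+|m|)!}\,r^n P_n^{|m|}(\cos\theta)\,e^{im\varphi},$$ and $R_n^m\equiv 0$ for $|m|>n$; $i$ is the imaginary unit. Each $R_n^m$ is a homogeneous polynomial of degree $n$ in $(x,y,z)$ (this defines it also at points where $\theta,\varphi$ are not uniquely defined; $R_0^0\equiv 1$). The associated Legendre functions are, for integers $n,m\ge 0$, $$P_n^m(\mu)=\frac{(-1)^m(1-\mu^2)^{m/2}}{2^n n!}\frac{d^{m+n}}{d\mu^{m+n}}(\mu^2-1)^n.$$ Accordingly all indexed quantities built from $R_n^m$ vanish when $|m|>n$. *)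

theory Defs
  imports "HOL-Analysis.Analysis"
begin

text \<open>
  The half-integer power of \<open>1 - \<mu>\<^sup>2\<close> is written as a natural power of the square root, so that
  its value is 1 for \<open>m = 0\<close> also at \<open>\<mu> = 1\<close> and \<open>\<mu> = -1\<close> (\<open>0 powr 0\<close> would be 0).
\<close>
definition assoc_legendre :: "nat \<Rightarrow> nat \<Rightarrow> real \<Rightarrow> real" where
  "assoc_legendre n m \<mu> =
     (-1) ^ m * sqrt (1 - \<mu>\<^sup>2) ^ m / (2 ^ n * fact n)
       * (deriv ^^ (m + n)) (\<lambda>t. (t\<^sup>2 - 1) ^ n) \<mu>"

definition spherical_point :: "real \<Rightarrow> real \<Rightarrow> real \<Rightarrow> real ^ 3" where
  "spherical_point r \<theta> \<phi> = vector [r * sin \<theta> * cos \<phi>, r * sin \<theta> * sin \<phi>, r * cos \<theta>]"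

definition harmonic_spherical :: "nat \<Rightarrow> int \<Rightarrow> real \<Rightarrow> real \<Rightarrow> real \<Rightarrow> complex" where
  "harmonic_spherical n m r \<theta> \<phi> =
     (if \<bar>m\<bar> > int n then 0
      else (-1) ^ n * \<i> ^ nat \<bar>m\<bar> / fact (n + nat \<bar>m\<bar>)
             * of_real (r ^ n * assoc_legendre n (nat \<bar>m\<bar>) (cos \<theta>))
             * exp (\<i> * of_int m * of_real \<phi>))"

text \<open>
  One choice of spherical coordinates is made at each point.  By \<open>harmonic_spherical_point\<close> below
  the value does not depend on it, also at the origin and on the polar axis.
\<close>
definition harmonic :: "nat \<Rightarrow> int \<Rightarrow> real ^ 3 \<Rightarrow> complex" where
  "harmonic n m p =
     harmonic_spherical n m (norm p) (arccos (p $ 3 / norm p)) (Arg (Complex (p $ 1) (p $ 2)))"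

lemma norm_spherical_point:
  assumes "r \<ge> 0"
  shows "norm (spherical_point r \<theta> \<phi>) = r"
proof -
  have "(r * sin \<theta> * cos \<phi>)\<^sup>2 + (r * sin \<theta> * sin \<phi>)\<^sup>2 + (r * cos \<theta>)\<^sup>2
      = r\<^sup>2 * ((sin \<theta>)\<^sup>2 * ((sin \<phi>)\<^sup>2 + (cos \<phi>)\<^sup>2) + (cos \<theta>)\<^sup>2)"
    by (simp only: power_mult_distrib) (simp only: algebra_simps)
  also have "\<dots> = r\<^sup>2"
    by simp
  finally show ?thesis
    using assms by (simp add: norm_vec_def L2_set_def sum_3 spherical_point_def)
qed

lemma harmonic_spherical_point:
  assumes "r \<ge> 0" "0 \<le> \<theta>" "\<theta> \<le> pi"
  shows "harmonic n m (spherical_point r \<theta> \<phi>) = harmonic_spherical n m r \<theta> \<phi>"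
proof (cases "r = 0")
  case True
  show ?thesis
  proof (cases "n = 0")
    case True
    then show ?thesis
      by (auto simp: harmonic_def harmonic_spherical_def assoc_legendre_def
          norm_spherical_point assms)
  next
    case False
    then show ?thesis using \<open>r = 0\<close>
      by (simp add: harmonic_def harmonic_spherical_def norm_spherical_point)
  qed
next
  case False
  with assms have r: "r > 0" by simp
  let ?p = "spherical_point r \<theta> \<phi>"
  have nrm: "norm ?p = r" using norm_spherical_point assms by simp
  have th: "arccos (?p $ 3 / r) = \<theta>"
    using r assms by (simp add: spherical_point_def arccos_cos)
  show ?thesis
  proof (cases "sin \<theta> = 0")
    case True
    then have "(cos \<theta>)\<^sup>2 = 1" using sin_cos_squared_add[of \<theta>] by simp
    then have "assoc_legendre n k (cos \<theta>) = 0" if "k > 0" for k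
      using that by (simp add: assoc_legendre_def)
    then show ?thesis
      by (cases "m = 0") (simp_all add: harmonic_def harmonic_spherical_def nrm th)
  next
    case False
    with assms have s: "sin \<theta> > 0" using sin_ge_zero[of \<theta>] by simp
    let ?w = "Complex (?p $ 1) (?p $ 2)"
    have w: "?w = of_real (r * sin \<theta>) * cis \<phi>"
      by (simp add: complex_eq_iff spherical_point_def)
    have nw: "norm ?w = r * sin \<theta>"
      unfolding w using r s by (simp add: norm_mult)
    have "?w \<noteq> 0" using nw r s by auto
    then have "cis (Arg ?w) = sgn ?w" by (rule cis_Arg)
    also have "\<dots> = cis \<phi>"
      using r s by (simp only: sgn_div_norm nw) (simp add: w scaleR_conv_of_real field_simps)
    finally have "cis (Arg ?w) = cis \<phi>" .
    then have "exp (\<i> * of_int m * of_real (Arg ?w)) = exp (\<i> * of_int m * of_real \<phi>)"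
      by (metis DeMoivre2 cis_conv_exp cis_power_int mult.assoc of_real_mult of_real_of_int_eq)
    then show ?thesis
      by (simp add: harmonic_def harmonic_spherical_def nrm th)
  qed
qed

definition g_coeff :: "real ^ 3 \<Rightarrow> real ^ 3 \<Rightarrow> real ^ 3 \<Rightarrow> nat \<Rightarrow> int \<Rightarrow> real \<Rightarrow> real \<Rightarrow> complex" where
  "g_coeff Ru Rv R0 n m u v = harmonic n m (u *\<^sub>R Ru + v *\<^sub>R Rv + R0)"

definition j_coeff :: "real ^ 3 \<Rightarrow> real ^ 3 \<Rightarrow> real ^ 3 \<Rightarrow> nat \<Rightarrow> int \<Rightarrow> complex" where
  "j_coeff Ru Rv R0 n m = integral {0..1} (\<lambda>u. g_coeff Ru Rv R0 n m u (1 - u))"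

definition k_coeff :: "real ^ 3 \<Rightarrow> real ^ 3 \<Rightarrow> real ^ 3 \<Rightarrow> nat \<Rightarrow> int \<Rightarrow> complex" where
  "k_coeff Ru Rv R0 n m = g_coeff Ru Rv R0 n m 1 0"

definition xi :: "real ^ 3 \<Rightarrow> complex" where
  "xi p = (of_real (p $ 1) + \<i> * of_real (p $ 2)) / 2"

definition eta :: "real ^ 3 \<Rightarrow> complex" where
  "eta p = (of_real (p $ 1) - \<i> * of_real (p $ 2)) / 2"

end

theory Submission
  imports Defs "HOL-Computational_Algebra.Polynomial"
begin

text \<open>
  \<open>R\<^sub>n\<^sup>m\<close> is the coefficient of \<open>t\<^sup>m\<close> in \<open>(i \<eta> / t - z + i \<xi> t)\<^sup>n / n!\<close>.  Both the recursion in \<open>n\<close> and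
  the gradient formulas are immediate from this: along \<open>p = a + u b\<close> one gets Euler's identity
  \<open>n R = u R' + a \<cdot> \<nabla>R\<close>, so that \<open>(u R)' = (n + 1) R - a \<cdot> \<nabla>R\<close>, and it remains to integrate over
  \<open>[0, 1]\<close>.  Here \<open>a = R\<^sub>0 + R\<^sub>v\<close> and \<open>a \<cdot> \<nabla>R\<close> is the combination of the functions of degree \<open>n - 1\<close>
  in the recursion.

  The coefficient formula comes from Taylor's theorem: the \<open>k\<close>-th derivative of \<open>(\<mu>\<^sup>2 - 1)\<^sup>n\<close> is
  \<open>k!\<close> times the coefficient of \<open>h\<^sup>k\<close> in \<open>(\<mu>\<^sup>2 - 1 + 2 \<mu> h + h\<^sup>2)\<^sup>n\<close>, and the substitution
  \<open>h = - i sin \<theta> e\<^bsup>i \<phi>\<^esup> t\<close> turns the two trinomials into each other up to a factor.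
\<close>

section \<open>Coefficients of powers of a Laurent trinomial\<close>

text \<open>The coefficient of \<open>t\<^sup>m\<close> in the Laurent polynomial \<open>(a / t + b + c t)\<^sup>n\<close>.\<close>
fun trinom :: "'a::comm_ring_1 \<Rightarrow> 'a \<Rightarrow> 'a \<Rightarrow> nat \<Rightarrow> int \<Rightarrow> 'a" where
  "trinom a b c 0 m = (if m = 0 then 1 else 0)"
| "trinom a b c (Suc n) m =
     a * trinom a b c n (m + 1) + b * trinom a b c n m + c * trinom a b c n (m - 1)"

lemma trinom_eq_0: "\<bar>m\<bar> > int n \<Longrightarrow> trinom a b c n m = 0"
  by (induction n arbitrary: m) auto

lemma trinom_swap: "trinom a b c n (- m) = trinom c b a n m"
proof (induction n arbitrary: m)
  case (Suc n)
  have *: "- m + 1 = - (m - 1)" "- m - 1 = - (m + 1)"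
    by simp_all
  show ?case
    unfolding trinom.simps * Suc.IH by (rule add.commute[THEN trans]) (simp only: ac_simps)
qed simp

lemma of_real_trinom:
  "of_real (trinom a b c n m) =
     (trinom (of_real a) (of_real b) (of_real c) n m :: 'a::{real_algebra_1,comm_ring_1})"
  by (induction n arbitrary: m) auto

text \<open>This is the substitution of \<open>x t\<close> for \<open>t\<close>, with a constant
  \<open>y\<close> taken out of the power.\<close>

lemma trinom_scale:
  fixes x y :: "'a::field"
  assumes "x \<noteq> 0"
  shows "trinom (y * a / x) (y * b) (y * c * x) n m = y ^ n * x powi m * trinom a b c n m"
proof (induction n arbitrary: m)
  case (Suc n)
  have *: "x powi (m + 1) = x powi m * x" "x powi (m - 1) = x powi m / x"
    using assms by (auto simp: power_int_add power_int_diff)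
  show ?case
    unfolding trinom.simps Suc.IH * using assms by (simp add: field_simps)
qed simp

lemma trinom_0_0: "trinom 0 b 0 n m = (if m = 0 then b ^ n else 0)"
  by (induction n arbitrary: m) auto

text \<open>The quadratic is \<open>t\<close> times the Laurent trinomial, so its
  \<open>n\<close>-th power has all exponents raised by \<open>n\<close>.\<close>

lemma coeff_trinomial_power: "coeff ([:a, b, c:] ^ n) k = trinom a b c n (int k - int n)"
proof (induction n arbitrary: k)
  case 0
  show ?case by (cases k) auto
next
  case (Suc n)
  \<comment> \<open>For \<open>k < 2\<close> some of the three terms of the recursion have index
    below \<open>- int n\<close> and vanish.\<close>
  consider "k = 0" | "k = 1" | l where "k = Suc (Suc l)"
    by (metis One_nat_def not0_implies_Suc)
  then show ?case
  proof cases
    case 1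
    then show ?thesis using Suc[of 0] by (simp add: trinom_eq_0)
  next
    case 2
    then show ?thesis using Suc[of 0] Suc[of 1]
      by (simp add: trinom_eq_0 coeff_pCons)
  next
    case 3
    then show ?thesis using Suc[of k] Suc[of "Suc l"] Suc[of l]
      by (simp add: algebra_simps)
  qed
qed

section \<open>Legendre functions through Taylor coefficients\<close>

lemma higher_deriv_poly:
  fixes p :: "'a::real_normed_field poly"
  shows "(deriv ^^ k) (poly p) = poly ((pderiv ^^ k) p)"
proof (induction k)
  case (Suc k)
  have "deriv (poly q) = poly (pderiv q)" for q :: "'a poly"
    by (rule ext, rule DERIV_imp_deriv, rule poly_DERIV)
  then show ?case by (simp add: Suc)
qed simp

lemma higher_pderiv_pcompose_shift:
  fixes p :: "'a::idom poly"
  shows "(pderiv ^^ k) (pcompose p [:x, 1:]) = pcompose ((pderiv ^^ k) p) [:x, 1:]"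
  by (induction k) (simp_all add: pderiv_pcompose pderiv_pCons)

lemma poly_higher_pderiv:
  fixes p :: "'a::{idom,semiring_char_0} poly"
  shows "poly ((pderiv ^^ k) p) x = fact k * coeff (pcompose p [:x, 1:]) k"
proof -
  have "poly ((pderiv ^^ k) p) x = coeff ((pderiv ^^ k) (pcompose p [:x, 1:])) 0"
    by (simp add: higher_pderiv_pcompose_shift flip: poly_0_coeff_0) (simp add: poly_pcompose)
  then show ?thesis
    by (simp add: coeff_higher_pderiv pochhammer_fact)
qed

lemma pcompose_power: "pcompose (p ^ n) q = pcompose p q ^ n" for p q :: "'a::comm_ring_1 poly"
  by (induction n) (simp_all add: pcompose_mult pcompose_1)

text \<open>Expanding at \<open>x\<close>, \<open>(x + h)^2 - 1 = (x^2 - 1) + 2 x h + h^2\<close>;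
  the Taylor coefficient of order \<open>m + n\<close> of the \<open>n\<close>-th power has index
  \<open>m\<close> after the shift by \<open>n\<close>.\<close>

lemma assoc_legendre_trinom:
  "assoc_legendre n m x =
     (-1) ^ m * sqrt (1 - x\<^sup>2) ^ m * fact (n + m) / (2 ^ n * fact n)
       * trinom (x\<^sup>2 - 1) (2 * x) 1 n (int m)"
proof -
  have eq: "(\<lambda>t::real. (t\<^sup>2 - 1) ^ n) = poly ([:-1, 0, 1:] ^ n)"
    by (simp add: fun_eq_iff poly_power power2_eq_square algebra_simps)
  have "pcompose [:-1, 0, 1:] [:x, 1:] = [:x\<^sup>2 - 1, 2 * x, 1:]"
    by (simp add: pcompose_pCons power2_eq_square)
  then have "(deriv ^^ (m + n)) (\<lambda>t. (t\<^sup>2 - 1) ^ n) x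
      = fact (m + n) * trinom (x\<^sup>2 - 1) (2 * x) 1 n (int m)"
    unfolding eq higher_deriv_poly poly_higher_pderiv
    by (simp add: pcompose_power coeff_trinomial_power)
  then show ?thesis
    unfolding assoc_legendre_def by (simp add: add.commute)
qed

section \<open>Harmonic polynomials as trinomial coefficients\<close>

lemma harmonic_spherical_nonneg:
  fixes \<phi> :: real
  assumes th: "0 \<le> \<theta>" "\<theta> \<le> pi" and "m \<ge> 0"
  defines "e \<equiv> cis \<phi>"
  shows "harmonic_spherical n m r \<theta> \<phi> =
    trinom (\<i> * (of_real (r * sin \<theta>) / e / 2)) (- of_real (r * cos \<theta>))
      (\<i> * (of_real (r * sin \<theta>) * e / 2)) n m / fact n"
proof (cases "m > int n")
  case True
  then show ?thesis by (simp add: harmonic_spherical_def trinom_eq_0)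
next
  case False
  obtain k where k: "m = int k" using \<open>m \<ge> 0\<close> nonneg_int_cases by blast
  have s: "sqrt (1 - (cos \<theta>)\<^sup>2) = sin \<theta>"
    using th sin_ge_zero by (simp flip: sin_squared_eq)
  \<comment> \<open>\<open>x\<close> is the ratio \<open>h / t\<close> of the substitution, and
    \<open>y\<close> absorbs the factor \<open>(-1)^n r^n / 2^n\<close>.\<close>
  define x where "x = - \<i> * of_real (sin \<theta>) * e"
  define y where "y = - (of_real r :: complex) / 2"
  define t :: complex where "t = of_real (trinom ((cos \<theta>)\<^sup>2 - 1) (2 * cos \<theta>) 1 n m)"
  have t: "t = trinom (of_real ((cos \<theta>)\<^sup>2 - 1)) (2 * of_real (cos \<theta>)) 1 n m"
    unfolding t_def of_real_trinom by simp
  have ex: "exp (\<i> * of_int m * of_real \<phi>) = e ^ k"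
    by (simp add: k e_def cis_conv_exp ac_simps flip: exp_of_nat_mult)
  have "e \<noteq> 0" by (simp add: e_def)
  have lhs: "harmonic_spherical n m r \<theta> \<phi> = y ^ n * x ^ k * t / fact n"
  proof -
    have "harmonic_spherical n m r \<theta> \<phi> = (-1) ^ n * \<i> ^ k / fact (n + k) *
        (of_real r ^ n * ((-1) ^ k * of_real (sin \<theta>) ^ k * fact (n + k) / (2 ^ n * fact n) * t)) * e ^ k"
      using False ex unfolding harmonic_spherical_def assoc_legendre_trinom s t_def
      by (simp add: k)
    also have "\<dots> = ((-1) ^ n * of_real r ^ n / 2 ^ n) * ((-1) ^ k * \<i> ^ k * of_real (sin \<theta>) ^ k * e ^ k)
        * t / fact n"
      by (simp add: field_simps)
    also have "(-1) ^ n * of_real r ^ n / 2 ^ n = y ^ n"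
      unfolding y_def by (metis mult_minus1 power_divide power_mult_distrib)
    also have "(-1) ^ k * \<i> ^ k * of_real (sin \<theta>) ^ k * e ^ k = x ^ k"
      unfolding x_def by (simp flip: power_mult_distrib)
    finally show ?thesis .
  qed
  show ?thesis
  proof (cases "sin \<theta> = 0")
    case True
    then have c: "(cos \<theta>)\<^sup>2 = 1" using sin_cos_squared_add[of \<theta>] by simp
    have "t = of_real (coeff ([:0, 2 * cos \<theta>, 1:] ^ n) (n + k))"
      unfolding t_def coeff_trinomial_power by (simp add: c k)
    moreover have "coeff ([:0, 2 * cos \<theta>, 1:] ^ n) n = (2 * cos \<theta>) ^ n"
    proof -
      have "[:0, 2 * cos \<theta>, 1:] ^ n = monom 1 n * [:2 * cos \<theta>, 1:] ^ n"
        by (simp add: monom_altdef flip: power_mult_distrib)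
      then show ?thesis by (simp add: coeff_monom_mult flip: poly_0_coeff_0)
    qed
    moreover have "y ^ n * (2 * of_real (cos \<theta>)) ^ n = (- of_real (r * cos \<theta>)) ^ n"
      by (subst power_mult_distrib[symmetric]) (simp add: y_def)
    moreover have "x = 0"
      using True by (simp add: x_def)
    ultimately show ?thesis
      using True unfolding lhs by (cases "k = 0") (simp_all add: k trinom_0_0)
  next
    case False
    then have "x \<noteq> 0" using \<open>e \<noteq> 0\<close> by (simp add: x_def)
    have cs: "of_real ((cos \<theta>)\<^sup>2 - 1) = - (of_real (sin \<theta>) :: complex)\<^sup>2"
      by (simp add: cos_squared_eq)
    have a: "y * of_real ((cos \<theta>)\<^sup>2 - 1) / x = \<i> * (of_real (r * sin \<theta>) / e / 2)"
      unfolding cs using False \<open>e \<noteq> 0\<close> by (simp add: x_def y_def field_simps power2_eq_square)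
    have b: "y * (2 * of_real (cos \<theta>)) = - of_real (r * cos \<theta>)"
      by (simp add: y_def)
    have c: "y * 1 * x = \<i> * (of_real (r * sin \<theta>) * e / 2)"
      by (simp add: x_def y_def)
    have "y ^ n * x ^ k * t = trinom (y * of_real ((cos \<theta>)\<^sup>2 - 1) / x)
        (y * (2 * of_real (cos \<theta>))) (y * 1 * x) n m"
      unfolding trinom_scale[OF \<open>x \<noteq> 0\<close>] t by (simp add: k)
    then show ?thesis unfolding lhs a b c by simp
  qed
qed

lemma harmonic_spherical_uminus: "harmonic_spherical n (- m) r \<theta> \<phi> = harmonic_spherical n m r \<theta> (- \<phi>)"
  by (simp add: harmonic_spherical_def)

text \<open>For negative \<open>m\<close>, changing the signs of \<open>m\<close> and \<phi>
  together preserves the function, and on the trinomial side it exchanges the outer coefficients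
  twice.\<close>

lemma harmonic_spherical_trinom:
  assumes "0 \<le> \<theta>" "\<theta> \<le> pi"
  shows "harmonic_spherical n m r \<theta> \<phi> =
    trinom (\<i> * (of_real (r * sin \<theta>) / cis \<phi> / 2)) (- of_real (r * cos \<theta>))
      (\<i> * (of_real (r * sin \<theta>) * cis \<phi> / 2)) n m / fact n"
proof (cases "m \<ge> 0")
  case True
  then show ?thesis using harmonic_spherical_nonneg assms by blast
next
  case False
  have cis: "w / cis (- \<phi>) = w * cis \<phi>" "w * cis (- \<phi>) = w / cis \<phi>" for w
    by (simp_all add: divide_inverse)
  from False have "harmonic_spherical n m r \<theta> \<phi> =
    trinom (\<i> * (of_real (r * sin \<theta>) * cis \<phi> / 2)) (- of_real (r * cos \<theta>))
      (\<i> * (of_real (r * sin \<theta>) / cis \<phi> / 2)) n (- m) / fact n"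
    using harmonic_spherical_nonneg[OF assms, of "- m" n r "- \<phi>"]
      harmonic_spherical_uminus[of n "- m" r \<theta> \<phi>]
    unfolding cis by simp
  then show ?thesis by (simp only: trinom_swap)
qed

lemma harmonic_trinom:
  "harmonic n m p = trinom (\<i> * eta p) (- of_real (p $ 3)) (\<i> * xi p) n m / fact n"
proof -
  define r where "r = norm p"
  define \<theta> where "\<theta> = arccos (p $ 3 / r)"
  define w where "w = Complex (p $ 1) (p $ 2)"
  have sq: "r\<^sup>2 = (norm w)\<^sup>2 + (p $ 3)\<^sup>2" 
    by (simp add: r_def w_def norm_vec_def L2_set_def sum_3 cmod_power2)
  have le: "\<bar>p $ 3 / r\<bar> \<le> 1"
    using component_le_norm_cart[of p 3] by (auto simp: r_def divide_le_eq)
  \<comment> \<open>At the origin \<theta> is the arccosine of \<open>0 / 0 = 0\<close>, but both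
    sides are 0 there.\<close>
  have z: "r * cos \<theta> = p $ 3"
    using le component_le_norm_cart[of p 3]
    by (cases "r = 0") (auto simp: \<theta>_def r_def cos_arccos_abs)
  have th: "0 \<le> \<theta>" "\<theta> \<le> pi"
    using le unfolding \<theta>_def by (auto simp only: abs_le_iff minus_le_iff intro!: arccos_lbound arccos_ubound)
  have "(r * sin \<theta>)\<^sup>2 = (norm w)\<^sup>2"
    using sq by (simp add: power_mult_distrib sin_squared_eq algebra_simps flip: z)
  then have "r * sin \<theta> = norm w"
    using th sin_ge_zero by (simp add: r_def power2_eq_iff_nonneg)
  then have rs: "of_real (r * sin \<theta>) * cis (Arg w) = w"
    using rcis_cmod_Arg by (simp add: rcis_def)
  moreover have "of_real (r * sin \<theta>) / cis (Arg w) = cnj w"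
    using arg_cong[OF rs, of cnj] by (simp add: divide_inverse cis_cnj)
  moreover have "xi p = w / 2" "eta p = cnj w / 2"
    by (simp_all add: xi_def eta_def w_def complex_eq_iff)
  ultimately show ?thesis
    unfolding harmonic_def r_def[symmetric] \<theta>_def[symmetric] w_def[symmetric]
      harmonic_spherical_trinom[OF th] z by (simp only:)
qed

section \<open>Differentiation and integration along a line\<close>

text \<open>This is the power rule for \<open>(a / t + b + c t)^(n + 1)\<close>: the inner
  derivative \<open>a' / t + b' + c' t\<close> multiplies the \<open>n\<close>-th power and shifts
  indices by at most one.\<close>

lemma has_field_derivative_trinom:
  fixes a b c :: "'a::real_normed_field \<Rightarrow> 'a"
  assumes [derivative_intros]: "(a has_field_derivative a') (at u within S)"
    "(b has_field_derivative b') (at u within S)" "(c has_field_derivative c') (at u within S)"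
  shows "((\<lambda>u. trinom (a u) (b u) (c u) (Suc n) m) has_field_derivative
    of_nat (Suc n) * (a' * trinom (a u) (b u) (c u) n (m + 1) + b' * trinom (a u) (b u) (c u) n m
      + c' * trinom (a u) (b u) (c u) n (m - 1))) (at u within S)"
proof (induction n arbitrary: m)
  case 0
  show ?case unfolding trinom.simps by (auto intro!: derivative_eq_intros assms)
next
  case (Suc n)
  note [derivative_intros] = Suc.IH
  show ?case
    by (subst trinom.simps(2)) (rule derivative_eq_intros refl | simp add: algebra_simps)+
qed

lemma trinom_integral:
  fixes a0 a1 b0 b1 c0 c1 :: complex
  defines "T \<equiv> \<lambda>n m u. trinom (a0 + of_real u * a1) (b0 + of_real u * b1) (c0 + of_real u * c1) n m"
  shows "of_nat (n + 2) * integral {0..1} (T (Suc n) m) =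
    of_nat (Suc n) * (a0 * integral {0..1} (T n (m + 1)) + b0 * integral {0..1} (T n m)
      + c0 * integral {0..1} (T n (m - 1))) + T (Suc n) m 1"
proof -
  \<comment> \<open>The factor \<open>w\<close> makes the boundary term at 0 vanish. In the product
    rule \<open>w * a1\<close> is the full coefficient minus \<open>a0\<close>, and likewise for
    \<open>b1\<close> and \<open>c1\<close>; the full coefficients reassemble to degree
    \<open>Suc n\<close>, which gives Euler's identity.\<close>
  define F where "F = (\<lambda>w. w * trinom (a0 + w * a1) (b0 + w * b1) (c0 + w * c1) (Suc n) m)"
  have int: "(T k l) integrable_on {0..1}" for k l
  proof (rule integrable_continuous_real)
    show "continuous_on {0..1} (T k l)"
      unfolding T_def
      by (induction k arbitrary: l) (auto intro!: continuous_intros)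
  qed
  define D where "D = (\<lambda>u. of_nat (n + 2) * T (Suc n) m u -
    of_nat (Suc n) * (a0 * T n (m + 1) u + b0 * T n m u + c0 * T n (m - 1) u))"
  have "(F has_field_derivative D u) (at (of_real u) within S)" for u S
    unfolding F_def
    by (rule derivative_eq_intros has_field_derivative_trinom refl)+
      (simp add: D_def T_def algebra_simps)
  then have "((\<lambda>u. F (of_real u)) has_vector_derivative D u) (at u within {0..1})" for u
    by (rule has_vector_derivative_real_field)
  then have "(D has_integral F (of_real 1) - F (of_real 0)) {0..1}"
    by (intro fundamental_theorem_of_calculus) auto
  then have "integral {0..1} D = T (Suc n) m 1"
    by (simp add: F_def T_def integral_unique)
  moreover have "integral {0..1} D = of_nat (n + 2) * integral {0..1} (T (Suc n) m) -
    of_nat (Suc n) * (a0 * integral {0..1} (T n (m + 1)) + b0 * integral {0..1} (T n m)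
      + c0 * integral {0..1} (T n (m - 1)))"
    unfolding D_def
    by (simp add: int integral_diff integral_add integrable_diff integrable_add
        integrable_on_mult_right del: of_nat_Suc of_nat_add)
  ultimately show ?thesis by (metis diff_eq_eq add.commute)
qed

theorem lemma3:
  fixes Ru Rv R0 :: "real ^ 3" and n :: nat and m :: int
  assumes "n \<ge> 1" and "- int n \<le> m" and "m \<le> int n"
  shows "j_coeff Ru Rv R0 n m =
    1 / (of_nat n + 1) *
      (\<i> * (xi R0 + xi Rv) * j_coeff Ru Rv R0 (n - 1) (m - 1)
       + \<i> * (eta R0 + eta Rv) * j_coeff Ru Rv R0 (n - 1) (m + 1)
       - of_real (R0 $ 3 + Rv $ 3) * j_coeff Ru Rv R0 (n - 1) m
       + k_coeff Ru Rv R0 n m)"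
proof -
  \<comment> \<open>With \<open>v = 1 - u\<close> the argument is
    \<open>(R0 + Rv) + u (Ru - Rv)\<close>, so the constant terms are the coefficients of the
    recursion.\<close>
  define T where "T = (\<lambda>n m u. trinom
    (\<i> * (eta R0 + eta Rv) + of_real u * (\<i> * (eta Ru - eta Rv)))
    (- of_real (R0 $ 3 + Rv $ 3) + of_real u * of_real (Rv $ 3 - Ru $ 3))
    (\<i> * (xi R0 + xi Rv) + of_real u * (\<i> * (xi Ru - xi Rv))) n m)"
  have g: "g_coeff Ru Rv R0 k l u (1 - u) = T k l u / fact k" for k l u
    unfolding g_coeff_def harmonic_trinom T_def
    by (intro arg_cong2[where f = "(/)"] arg_cong3[where f = "\<lambda>a b c. trinom a b c k l"] refl)
      (simp_all add: eta_def xi_def field_simps)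
  have j: "j_coeff Ru Rv R0 k l = integral {0..1} (T k l) / fact k" for k l
    unfolding j_coeff_def g by simp
  have kk: "k_coeff Ru Rv R0 n m = T n m 1 / fact n"
    using g[of n m 1] by (simp add: k_coeff_def)
  obtain n' where n: "n = Suc n'" using \<open>n \<ge> 1\<close> by (cases n) auto
  define E where "E = \<i> * (eta R0 + eta Rv) * integral {0..1} (T n' (m + 1))
    + (- of_real (R0 $ 3 + Rv $ 3)) * integral {0..1} (T n' m)
    + \<i> * (xi R0 + xi Rv) * integral {0..1} (T n' (m - 1))"
  have key: "of_nat (n' + 2) * integral {0..1} (T n m) = of_nat n * E + T n m 1"
    unfolding n E_def T_def by (rule trinom_integral)
  have nz: "of_nat n \<noteq> (0::complex)" "of_nat (n' + 2) \<noteq> (0::complex)"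
    unfolding n of_nat_eq_0_iff by simp_all
  have "integral {0..1} (T n m) = (of_nat n * E + T n m 1) / of_nat (n' + 2)"
    using nz(2) by (simp only: key[symmetric] nonzero_mult_div_cancel_left not_False_eq_True)
  then have "j_coeff Ru Rv R0 n m = 1 / of_nat (n' + 2) * (of_nat n * E / fact n + T n m 1 / fact n)"
    unfolding j by (simp only: add_divide_distrib[symmetric] divide_divide_eq_left
        times_divide_eq_left times_divide_eq_right mult_1_left mult.commute)
  \<comment> \<open>The factor \<open>n\<close> from the derivative turns \<open>1 / n!\<close> into
    the normalization \<open>1 / (n - 1)!\<close> of the lower degree.\<close>
  also have "of_nat n * E / fact n = E / fact n'"
    using nz(1) by (simp add: n del: of_nat_Suc)
  also have "of_nat (n' + 2) = (of_nat n + 1 :: complex)"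
    by (simp add: n)
  also have "E / fact n' = \<i> * (xi R0 + xi Rv) * j_coeff Ru Rv R0 (n - 1) (m - 1)
       + \<i> * (eta R0 + eta Rv) * j_coeff Ru Rv R0 (n - 1) (m + 1)
       - of_real (R0 $ 3 + Rv $ 3) * j_coeff Ru Rv R0 (n - 1) m"
    unfolding E_def j n diff_Suc_1
    by (simp only: add_divide_distrib times_divide_eq_right mult_minus_left divide_minus_left) simp
  finally show ?thesis
    unfolding kk .
qed

end
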